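(* Let $T>0$, let $\sigma:\mathbb R\to\mathbb R$ be continuous, and let $d\geq n\geq1$ be integers. Let $y^{(1)},\dots,y^{(n)}\in\mathbb R^d$ be such that $$\operatorname{rank}\big[\sigma(y^{(1)}),\dots,\sigma(y^{(n)})\big]=n .$$ Then there exist $\varepsilon>0$ and $C>0$ such that for all $x^{(1)},\dots,x^{(n)}\in\mathbb R^d$ with $$\max_{i\in\{1,\dots,n\}}\|x^{(i)}-y^{(i)}\|_1\leq\varepsilon,$$ there exist $w\in\mathscr C^0([0,T];\mathbb R^{d\times d})$ and $(x_1(\cdot),\dots,x_n(\cdot))\in\mathscr C^1([0,T];\mathbb R^{nd})$ satisfying, for all $i\in\{1,\dots,n\}$, $$\begin{cases}\dot x_i(t)=w(t)\,\sigma(x_i(t))&\text{for }t\in[0,T],\\ x_i(0)=x^{(i)},\\ x_i(T)=y^{(i)},\end{cases}$$ and moreover $$\|w\|_{\mathscr C^0([0,T];\mathbb R^{d\times d})}\leq\frac{C}{T}\max_{i\in\{1,\dots,n\}}\|x^{(i)}-y^{(i)}\|_1 .$$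
   Context: The function $\sigma$ is extended to $\mathbb R^d$ component-wise, $\sigma(x)=(\sigma(x_1),\dots,\sigma(x_d))$, and $[\sigma(y^{(1)}),\dots,\sigma(y^{(n)})]$ is the $d\times n$ matrix with the indicated columns. $\|\cdot\|_1$ is the $\ell^1$ norm on $\mathbb R^d$. $\|w\|_{\mathscr C^0([0,T];\mathbb R^{d\times d})}=\max_{t\in[0,T]}\|w(t)\|$ for a fixed matrix norm (all norms being equivalent, its choice only affects $C$). *)

theory Defs
  imports "HOL-Analysis.Analysis"
begin

definition componentwise :: "(real \<Rightarrow> real) \<Rightarrow> real ^ 'd \<Rightarrow> real ^ 'd" where
  "componentwise \<sigma> x = (\<chi> k. \<sigma> (x $ k))"

definition matrix_of_columns :: "('n \<Rightarrow> real ^ 'd) \<Rightarrow> real ^ 'n ^ 'd" where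
  "matrix_of_columns v = (\<chi> k j. v j $ k)"

text \<open>The library's \<open>norm\<close> on \<open>real ^ 'd\<close> is the Euclidean one.\<close>

definition l1_norm :: "real ^ 'd \<Rightarrow> real" where
  "l1_norm x = (\<Sum>k\<in>UNIV. \<bar>x $ k\<bar>)"

text \<open>An arbitrary norm on a real vector space, not necessarily the one carried by the type
  (for \<open>real ^ 'd ^ 'd\<close>, the Frobenius norm). Nonnegativity follows from the other axioms.\<close>

definition is_norm :: "('a::real_vector \<Rightarrow> real) \<Rightarrow> bool" where
  "is_norm N \<longleftrightarrow>
     (\<forall>a. N a = 0 \<longleftrightarrow> a = 0) \<and>
     (\<forall>c a. N (c *\<^sub>R a) = \<bar>c\<bar> * N a) \<and>
     (\<forall>a b. N (a + b) \<le> N a + N b)"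

text \<open>For continuous \<open>w\<close> and \<open>0 \<le> T\<close> the supremum is attained, so it is the maximum;
  \<open>Max\<close> is only meaningful for finite sets.\<close>

definition C0_norm :: "('a::real_normed_vector \<Rightarrow> real) \<Rightarrow> real \<Rightarrow> (real \<Rightarrow> 'a) \<Rightarrow> real" where
  "C0_norm N T w = (SUP t\<in>{0..T}. N (w t))"

text \<open>Derivatives are one-sided at the endpoints. The library's \<open>C1_differentiable_on\<close> uses
  two-sided derivatives, which would constrain the function outside of the interval.\<close>

definition C1_on :: "real set \<Rightarrow> (real \<Rightarrow> 'a::real_normed_vector) \<Rightarrow> bool" where
  "C1_on S f \<longleftrightarrow>
     (\<exists>f'. (\<forall>t\<in>S. (f has_vector_derivative f' t) (at t within S)) \<and> continuous_on S f')"

end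

theory Submission
  imports Defs
begin

text \<open>Steer every point along the segment from \<open>x\<^sup>(\<^sup>i\<^sup>)\<close> to \<open>y\<^sup>(\<^sup>i\<^sup>)\<close>, run at constant speed.
  Full column rank is an open condition and a left inverse \<open>P\<close> of the matrix
  \<open>S(x) = [\<sigma>(x\<^sub>1), \<dots>, \<sigma>(x\<^sub>n)]\<close> can be chosen continuously in \<open>x\<close> near \<open>y\<close>; the control
  \<open>w(t) = [y - x] P(x(t)) / T\<close> then generates the segments and is linear in \<open>y - x\<close>.\<close>

lemma continuous_on_det:
  fixes A :: "'a::topological_space \<Rightarrow> real ^ 'n ^ 'n"
  assumes "continuous_on U A"
  shows "continuous_on U (\<lambda>x. det (A x))"
  unfolding det_def by (intro continuous_intros assms)

text \<open>Serves twice: products of continuous matrix functions are continuous, and the norm of a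
  product is at most a fixed multiple of the product of the norms.\<close>

lemma bounded_bilinear_matrix_mult:
  "bounded_bilinear (\<lambda>(A :: real ^ 'm ^ 'k) (B :: real ^ 'n ^ 'm). A ** B)"
  by (auto simp flip: bilinear_conv_bounded_bilinear scalar_matrix_assoc intro!: linearI
      simp: bilinear_def matrix_add_ldistrib matrix_scalar_ac)
     (simp_all add: matrix_matrix_mult_def vec_eq_iff algebra_simps sum.distrib)

text \<open>A tuple in \<open>real ^ 'd ^ 'n\<close> stores its points as rows, whereas the control
  uses them as columns; both arrangements have the same norm.\<close>

lemma norm_transpose: "norm (transpose A) = norm (A :: real ^ 'n ^ 'm)"
  unfolding norm_vec_def L2_set_def transpose_def
  by (simp add: sum_nonneg sum.swap[of _ "UNIV :: 'n set"])

lemma matrix_inv_inverse: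
  assumes "invertible A"
  shows "A ** matrix_inv A = mat 1" "matrix_inv A ** A = mat 1"
  using someI_ex[OF assms[unfolded invertible_def]] by (auto simp: matrix_inv_def)

text \<open>By Cramer's rule every entry of the inverse is a quotient of determinants, and these are
  polynomials in the entries of the matrix.\<close>

lemma continuous_on_matrix_inv:
  fixes A :: "'a::topological_space \<Rightarrow> real ^ 'n ^ 'n"
  assumes cont: "continuous_on U A" and det: "\<And>x. x \<in> U \<Longrightarrow> det (A x) \<noteq> 0"
  shows "continuous_on U (\<lambda>x. matrix_inv (A x))"
proof -
  define R where "R x = (\<chi> k j. det (\<chi> i l. if l = k then axis j 1 $ i else A x $ i $ l) / det (A x))" for x
  have "matrix_inv (A x) = R x" if "x \<in> U" for x
  proof -
    have "invertible (A x)"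
      using det[OF that] by (simp add: invertible_det_nz)
    have "A x *v (matrix_inv (A x) *v axis j 1) = axis j 1" for j
      by (simp add: matrix_vector_mul_assoc matrix_inv_inverse \<open>invertible (A x)\<close>)
    \<comment> \<open>Column \<open>j\<close> of the inverse solves the linear system with
      right-hand side \<open>axis j 1\<close>, and \<open>cramer\<close> gives the only
      solution.\<close>
    then have "column j (matrix_inv (A x)) = column j (R x)" for j
      using det[OF that]
      by (simp add: cramer matrix_vector_mult_basis R_def column_def)
    then show ?thesis
      by (simp add: column_def vec_eq_iff)
  qed
  moreover have "continuous_on U (\<lambda>x. if l = k then axis j 1 $ i else A x $ i $ l)" for i j k l
    by (cases "l = k") (auto intro!: continuous_intros cont)
  then have "continuous_on U R"
    unfolding R_def by (intro continuous_intros continuous_on_det cont) (use det in auto)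
  ultimately show ?thesis
    by (simp cong: continuous_on_cong)
qed

text \<open>With \<open>L\<close> a left inverse at \<open>y\<close>, the square matrix
  \<open>L ** S x\<close> is the identity at \<open>x = y\<close>, hence invertible on an open
  neighbourhood. There its inverse times \<open>L\<close> is a left inverse of \<open>S x\<close>,
  continuous in \<open>x\<close>.\<close>

lemma continuous_local_left_inverse:
  fixes S :: "'a::topological_space \<Rightarrow> real ^ 'n ^ 'd"
  assumes cont: "continuous_on UNIV S" and rank: "rank (S y) = CARD('n)"
  obtains U P where "open U" "y \<in> U" "continuous_on U P" "\<And>x. x \<in> U \<Longrightarrow> P x ** S x = mat 1"
proof -
  obtain L where L: "L ** S y = mat 1"
    using rank by (metis full_rank_injective matrix_left_invertible_injective)
  let ?A = "\<lambda>x. L ** S x"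
  let ?U = "{x. det (?A x) \<noteq> 0}"
  have cA: "continuous_on V ?A" for V
    by (intro bounded_bilinear.continuous_on[OF bounded_bilinear_matrix_mult] continuous_intros
        continuous_on_subset[OF cont]) auto
  show thesis
  proof
    show "open ?U"
      by (intro open_Collect_neq continuous_intros continuous_on_det cA)
    show "y \<in> ?U"
      by (simp add: L)
    show "continuous_on ?U (\<lambda>x. matrix_inv (?A x) ** L)"
      by (intro bounded_bilinear.continuous_on[OF bounded_bilinear_matrix_mult] continuous_intros
          continuous_on_matrix_inv cA) auto
    show "(matrix_inv (?A x) ** L) ** S x = mat 1" if "x \<in> ?U" for x
      using that by (simp add: matrix_inv_inverse invertible_det_nz flip: matrix_mul_assoc)
  qed
qed

text \<open>Expand in \<open>Basis\<close>: each coordinate is at most \<open>norm a\<close> in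
  absolute value, so the values of \<open>N\<close> on \<open>Basis\<close> sum up to a
  bound.\<close>

lemma is_norm_le_norm:
  fixes N :: "'a::euclidean_space \<Rightarrow> real"
  assumes "is_norm N"
  obtains K where "K > 0" "\<And>a. N a \<le> K * norm a"
proof -
  have zero: "N 0 = 0" and scale: "\<And>c a. N (c *\<^sub>R a) = \<bar>c\<bar> * N a"
    and tri: "\<And>a b. N (a + b) \<le> N a + N b"
    using assms by (auto simp: is_norm_def)
  have nonneg: "N a \<ge> 0" for a
    using tri[of a "-1 *\<^sub>R a"] scale[of "-1" a] zero by simp
  have sum_le: "N (sum f B) \<le> (\<Sum>b\<in>B. N (f b))" if "finite B" for f :: "'a \<Rightarrow> 'a" and B
    using that by induction (auto simp: zero intro: order_trans[OF tri])
  show thesis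
  proof
    \<comment> \<open>The summand 1 makes positivity immediate from \<open>nonneg\<close>.\<close>
    show "1 + sum N Basis > 0"
      using sum_nonneg[of Basis N] nonneg by (simp add: add_pos_nonneg)
    fix a :: 'a
    have "N a = N (\<Sum>b\<in>Basis. (a \<bullet> b) *\<^sub>R b)"
      by (simp add: euclidean_representation)
    also have "\<dots> \<le> (\<Sum>b\<in>Basis. \<bar>a \<bullet> b\<bar> * N b)"
      using sum_le[OF finite_Basis, of "\<lambda>b. (a \<bullet> b) *\<^sub>R b"] by (simp add: scale)
    also have "\<dots> \<le> (\<Sum>b\<in>Basis. norm a * N b)"
      by (intro sum_mono mult_right_mono Basis_le_norm nonneg)
    also have "\<dots> \<le> (1 + sum N Basis) * norm a"
      by (simp add: algebra_simps sum_distrib_left)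
    finally show "N a \<le> (1 + sum N Basis) * norm a" .
  qed
qed

text \<open>The Euclidean norm of the tuple is at most the sum of the Euclidean norms of its
  \<open>CARD('n)\<close> points, each dominated by an \<open_placeholder>\<close>

lemma norm_le_Max_l1_norm:
  fixes v :: "real ^ 'd ^ 'n"
  shows "norm v \<le> CARD('n) * (MAX i. l1_norm (v $ i))"
proof -
  have "norm v \<le> (\<Sum>i\<in>UNIV. norm (v $ i))"
    by (simp add: norm_vec_def L2_set_le_sum)
  also have "\<dots> \<le> (\<Sum>i::'n\<in>UNIV. MAX i. l1_norm (v $ i))"
    by (intro sum_mono order_trans[OF norm_le_l1_cart]) (auto simp: l1_norm_def intro: Max_ge)
  finally show ?thesis
    by simp
qed

lemma matrix_of_columns_eq_transpose: "matrix_of_columns (\<lambda>i. v $ i) = transpose v"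
  by (simp add: matrix_of_columns_def transpose_def)

lemma matrix_of_columns_mult_axis: "matrix_of_columns v *v axis i 1 = v i"
  by (simp add: matrix_vector_mult_basis column_def matrix_of_columns_def)

lemma continuous_on_componentwise:
  assumes "continuous_on UNIV \<sigma>"
  shows "continuous_on UNIV (componentwise \<sigma>)"
  unfolding componentwise_def
  by (intro continuous_intros continuous_on_compose2[OF assms]) auto

theorem proposition1p10:
  fixes T :: real
    and \<sigma> :: "real \<Rightarrow> real"
    and y :: "real ^ 'd ^ 'n"
    and mnorm :: "real ^ 'd ^ 'd \<Rightarrow> real"
  assumes "T > 0"
    and "continuous_on UNIV \<sigma>"
    and "CARD('d) \<ge> CARD('n)"
    and "rank (matrix_of_columns (\<lambda>i. componentwise \<sigma> (y $ i)) :: real ^ 'n ^ 'd) = CARD('n)"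
    and "is_norm mnorm"
  shows "\<exists>\<epsilon>>0. \<exists>C>0. \<forall>x0 :: real ^ 'd ^ 'n.
    (MAX i. l1_norm (x0 $ i - y $ i)) \<le> \<epsilon> \<longrightarrow>
    (\<exists>(w :: real \<Rightarrow> real ^ 'd ^ 'd) (x :: real \<Rightarrow> real ^ 'd ^ 'n).
       continuous_on {0..T} w \<and>
       C1_on {0..T} x \<and>
       (\<forall>i. (\<forall>t\<in>{0..T}. ((\<lambda>s. x s $ i) has_vector_derivative
                             w t *v componentwise \<sigma> (x t $ i)) (at t within {0..T})) \<and>
            x 0 $ i = x0 $ i \<and>
            x T $ i = y $ i) \<and>
       C0_norm mnorm T w \<le> C / T * (MAX i. l1_norm (x0 $ i - y $ i)))"
proof -
  let ?S = "\<lambda>x :: real ^ 'd ^ 'n. matrix_of_columns (\<lambda>i. componentwise \<sigma> (x $ i)) :: real ^ 'n ^ 'd"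
  have "continuous_on UNIV (\<lambda>x :: real ^ 'd ^ 'n. componentwise \<sigma> (x $ i))" for i
    by (intro continuous_on_compose2[OF continuous_on_componentwise[OF assms(2)]] continuous_intros)
       auto
  then have "continuous_on UNIV ?S"
    unfolding matrix_of_columns_def by (intro continuous_intros)
  then obtain U P where U: "open U" "y \<in> U" and "continuous_on U P"
    and PS: "\<And>x. x \<in> U \<Longrightarrow> P x ** ?S x = mat 1"
    using continuous_local_left_inverse assms(4) by blast
  obtain r where r: "r > 0" "cball y r \<subseteq> U"
    using U open_contains_cball by blast
  then have P: "continuous_on (cball y r) P"
    using \<open>continuous_on U P\<close> continuous_on_subset by blast
  then have "bounded (P ` cball y r)"
    by (intro compact_imp_bounded compact_continuous_image) auto
  then obtain M where M: "M > 0" "\<And>x. x \<in> cball y r \<Longrightarrow> norm (P x) \<le> M"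
    unfolding bounded_pos by auto
  obtain B where B: "B > 0"
    "\<And>(X :: real ^ 'n ^ 'd) (Y :: real ^ 'd ^ 'n). norm (X ** Y) \<le> norm X * norm Y * B"
    using bounded_bilinear.pos_bounded[OF bounded_bilinear_matrix_mult] by blast
  obtain K where K: "K > 0" "\<And>a. mnorm a \<le> K * norm a"
    using is_norm_le_norm[OF assms(5)] by blast
  have scale: "mnorm (c *\<^sub>R a) = \<bar>c\<bar> * mnorm a" for c a
    using assms(5) by (simp add: is_norm_def)
  let ?C = "K * (CARD('n) * M * B)"
  show ?thesis
  proof (intro exI conjI allI impI ballI)
    show "r / CARD('n) > 0" "?C > 0"
      using r(1) K(1) B(1) M(1) by simp_all
    fix x0 :: "real ^ 'd ^ 'n"
    let ?m = "MAX i. l1_norm (x0 $ i - y $ i)"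
    assume small: "?m \<le> r / CARD('n)"
    define x where "x t = x0 + (t / T) *\<^sub>R (y - x0)" for t
    define D where "D = matrix_of_columns (\<lambda>i. y $ i - x0 $ i)"
    define w where "w t = (1 / T) *\<^sub>R (D ** P (x t))" for t
    have m: "norm (x0 - y) \<le> CARD('n) * ?m"
      using norm_le_Max_l1_norm[of "x0 - y"] by simp
    also have "\<dots> \<le> r"
      using small by (simp add: field_simps)
    finally have x0: "x0 \<in> cball y r"
      by (simp add: dist_norm norm_minus_commute)
    have "x t = (1 - t / T) *\<^sub>R x0 + (t / T) *\<^sub>R y" for t
      by (simp add: x_def algebra_simps)
    then have xr: "x t \<in> cball y r" if "t \<in> {0..T}" for t
      using that x0 r(1) \<open>T > 0\<close> convexD[OF convex_cball, of x0 y r y "1 - t / T" "t / T"]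
      by simp
    have der: "(x has_vector_derivative (1 / T) *\<^sub>R (y - x0)) (at t within {0..T})" for t
      unfolding x_def using \<open>T > 0\<close>
      by (auto intro!: derivative_eq_intros simp: has_vector_derivative_def)
    have normD: "norm D = norm (x0 - y)"
    proof -
      have "D = transpose (y - x0)"
        by (simp add: D_def flip: matrix_of_columns_eq_transpose)
      then show ?thesis
        by (simp add: norm_transpose norm_minus_commute)
    qed
    have "continuous_on {0..T} x"
      unfolding x_def by (intro continuous_intros) (use \<open>T > 0\<close> in auto)
    then have "continuous_on {0..T} (\<lambda>t. P (x t))"
      by (rule continuous_on_compose2[OF P]) (use xr in blast)
    then show "continuous_on {0..T} w"
      unfolding w_def
      by (intro continuous_intros bounded_bilinear.continuous_on[OF bounded_bilinear_matrix_mult])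
    show "C1_on {0..T} x"
      unfolding C1_on_def using der by (intro exI[of _ "\<lambda>_. (1 / T) *\<^sub>R (y - x0)"]) auto
    show "x 0 $ i = x0 $ i" "x T $ i = y $ i" for i
      using \<open>T > 0\<close> by (simp_all add: x_def)
    show "((\<lambda>s. x s $ i) has_vector_derivative w t *v componentwise \<sigma> (x t $ i)) (at t within {0..T})"
      if t: "t \<in> {0..T}" for i t
    proof -
      have "P (x t) ** ?S (x t) = mat 1"
        using xr[OF t] r(2) by (intro PS) auto
      then have "D ** P (x t) *v (?S (x t) *v axis i 1) = D *v axis i 1"
        by (simp add: matrix_vector_mul_assoc flip: matrix_mul_assoc)
      then have "w t *v componentwise \<sigma> (x t $ i) = (1 / T) *\<^sub>R (y - x0) $ i"
        by (simp add: matrix_of_columns_mult_axis w_def D_def scaleR_matrix_vector_assoc[symmetric])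
      then show ?thesis
        using bounded_linear.has_vector_derivative[OF bounded_linear_vec_nth der] by simp
    qed
    show "C0_norm mnorm T w \<le> ?C / T * ?m"
      unfolding C0_norm_def
    proof (rule cSUP_least)
      show "{0..T} \<noteq> {}"
        using \<open>T > 0\<close> by simp
      fix t assume "t \<in> {0..T}"
      then have "norm (P (x t)) \<le> M"
        using xr M(2) by blast
      then have "norm D * norm (P (x t)) * B \<le> (CARD('n) * ?m) * M * B"
        using m normD B(1) M(1) by (intro mult_mono mult_nonneg_nonneg order_trans[OF norm_ge_zero m]) auto
      then have "norm (D ** P (x t)) \<le> (CARD('n) * ?m) * M * B"
        using B(2) order_trans by blast
      then have "mnorm (D ** P (x t)) \<le> K * ((CARD('n) * ?m) * M * B)"
        using K by (meson mult_left_mono less_imp_le order_trans)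
      then show "mnorm (w t) \<le> ?C / T * ?m"
        using \<open>T > 0\<close> by (simp add: w_def scale field_simps)
    qed
  qed
qed

end
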